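(* Let $A(z)$ be an $n\times n$ Hermite matrix of Laurent polynomials with $\det A(z)\not\equiv0$, and let $z_0=e^{-i\xi_0}\in\mathbb{T}$ with $\xi_0\in\mathbb{R}$. Let $d_1,\dots,d_n$ be the invariant polynomials of $A$ and $\alpha_j:=\operatorname{mz}(d_j,z_0)$. Let $\lambda_1(\xi),\dots,\lambda_n(\xi)$ be real-analytic functions on $\mathbb{R}$ such that for every $\xi\in\mathbb{R}$ the numbers $\lambda_1(\xi),\dots,\lambda_n(\xi)$ are the eigenvalues (with multiplicity) of $A(e^{-i\xi})$, indexed so that $\beta_1\le\dots\le\beta_n$ where $\beta_j:=\operatorname{mz}(\lambda_j,\xi_0)$. Then $(\alpha_1,\dots,\alpha_n)=(\beta_1,\dots,\beta_n)$.
   Context: For a matrix $U(z)=\sum_k U_k z^k$ of Laurent polynomials, $U^\star(z):=\sum_k\overline{U_k}^T z^{-k}$; Hermite means $A^\star=A$. $\mathbb{T}$ is the unit circle. A matrix of Laurent polynomials is unimodular if its determinant is a nonzero monomial. Every $n\times n$ matrix $A$ of Laurent polynomials with $\det A\not\equiv0$ factors as $A=E\operatorname{diag}(d_1,\dots,d_n)F$ with $E,F$ unimodular and polynomials $d_j$ with $d_j\mid d_{j+1}$, leading coefficient 1 and nonzero constant term; these $d_j$ are the invariant polynomials of $A$. For a Laurent polynomial $p\not\equiv0$ and $z_0\ne0$, $\operatorname{mz}(p,z_0)$ is the multiplicity of $z_0$ as a root of $p$. For an analytic function $f\not\equiv0$, $\operatorname{mz}(f,\xi_0)$ is the largest $m$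 with $f^{(k)}(\xi_0)=0$ for all $0\le k<m$. *)

theory Defs
  imports Complex_Main "HOL-Analysis.Derivative" "HOL-Library.Poly_Mapping" "Jordan_Normal_Form.Char_Poly"
begin

text \<open>Laurent polynomials over the complex numbers are modelled as finitely supported
  coefficient functions int =>0 complex; multiplication is convolution,
  so this is the ring of Laurent polynomials.  Matrices of Laurent polynomials are
  Jordan_Normal_Form matrices over this ring.\<close>

type_synonym lpoly = "int \<Rightarrow>\<^sub>0 complex"

definition leval :: "lpoly \<Rightarrow> complex \<Rightarrow> complex" where
  "leval p z = (\<Sum>k\<in>Poly_Mapping.keys p. Poly_Mapping.lookup p k * z powi k)"

definition lmat_eval :: "lpoly mat \<Rightarrow> complex \<Rightarrow> complex mat" where
  "lmat_eval A z = map_mat (\<lambda>p. leval p z) A"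

definition lpoly_of_poly :: "complex poly \<Rightarrow> lpoly" where
  "lpoly_of_poly p = Abs_poly_mapping (\<lambda>k. if k \<ge> 0 then coeff p (nat k) else 0)"

definition lmat_star :: "lpoly mat \<Rightarrow> lpoly mat" where
  "lmat_star A = mat (dim_col A) (dim_row A)
     (\<lambda>(i,j). Abs_poly_mapping (\<lambda>k. cnj (Poly_Mapping.lookup (A $$ (j,i)) (-k))))"

definition hermite_lmat :: "lpoly mat \<Rightarrow> bool" where
  "hermite_lmat A \<longleftrightarrow> lmat_star A = A"

definition unimodular_lmat :: "lpoly mat \<Rightarrow> bool" where
  "unimodular_lmat E \<longleftrightarrow> (\<exists>c k. c \<noteq> 0 \<and> det E = Poly_Mapping.single k c)"

definition invariant_polys :: "nat \<Rightarrow> lpoly mat \<Rightarrow> (nat \<Rightarrow> complex poly) \<Rightarrow> bool" where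
  "invariant_polys n A d \<longleftrightarrow>
     (\<exists>E F. E \<in> carrier_mat n n \<and> F \<in> carrier_mat n n \<and>
        unimodular_lmat E \<and> unimodular_lmat F \<and>
        A = E * mat n n (\<lambda>(i,j). if i = j then lpoly_of_poly (d i) else 0) * F) \<and>
     (\<forall>j<n. lead_coeff (d j) = 1 \<and> coeff (d j) 0 \<noteq> 0) \<and>
     (\<forall>j. Suc j < n \<longrightarrow> d j dvd d (Suc j))"

definition real_analytic_on :: "(real \<Rightarrow> real) \<Rightarrow> real set \<Rightarrow> bool" where
  "real_analytic_on f S \<longleftrightarrow>
     (\<forall>x\<in>S. \<exists>r>0. \<exists>c::nat \<Rightarrow> real. \<forall>y. \<bar>y - x\<bar> < r \<longrightarrow> (\<lambda>k. c k * (y - x) ^ k) sums f y)"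

definition mz_fun :: "(real \<Rightarrow> real) \<Rightarrow> real \<Rightarrow> nat" where
  "mz_fun f x = (GREATEST m. \<forall>k<m. (deriv ^^ k) f x = 0)"

definition mz_poly :: "complex poly \<Rightarrow> complex \<Rightarrow> nat" where
  "mz_poly p z = order z p"

end

theory Submission
  imports Defs "Jordan_Normal_Form.Schur_Decomposition" "HOL-Analysis.Complex_Transcendental"
begin

text \<open>
  On the unit circle write \<open>A(z) = E(z) D(z) F(z)\<close> with \<open>D = diag(d\<^sub>1, \<dots>, d\<^sub>n)\<close>. The singular values
  of the Hermitian matrix \<open>A(z)\<close> are the \<open>\<bar>\<lambda>\<^sub>j\<bar>\<close>, and those of \<open>D(z)\<close> are the \<open>\<bar>d\<^sub>j\<bar>\<close>. The \<open>j\<close> eigenvectors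
  for \<open>\<lambda>\<^sub>1, \<dots>, \<lambda>\<^sub>j\<close> and the preimage under \<open>F\<close> of the coordinate space of the indices \<open>\<ge> j\<close> have
  dimensions adding up to \<open>n + 1\<close>, hence a common nonzero vector, and so \<open>min\<^sub>i\<^sub>\<le>\<^sub>j \<bar>\<lambda>\<^sub>i\<bar> = O(max\<^sub>i\<^sub>\<ge>\<^sub>j \<bar>d\<^sub>i\<bar>)\<close>
  because \<open>E\<close> and \<open>F\<close> are bounded. Near \<open>\<xi>\<^sub>0\<close> this reads \<open>\<alpha>\<^sub>j \<le> \<beta>\<^sub>j\<close>. The determinants of \<open>E\<close> and \<open>F\<close> have
  constant modulus, so comparing \<open>\<Prod>\<bar>\<lambda>\<^sub>j\<bar>\<close> with \<open>\<Prod>\<bar>d\<^sub>j\<bar>\<close> gives \<open>\<Sum>\<beta>\<^sub>j \<le> \<Sum>\<alpha>\<^sub>j\<close>, and equality holds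
  throughout. No analytic choice of eigenvectors is involved.
\<close>

unbundle no vec_syntax

subsection \<open>Hermitian matrices and invariant flags\<close>

text \<open>The squared Euclidean norm, taken with real values so that it can enter inequalities;
  \<open>v \<bullet>c v\<close> is the same number as a complex one.\<close>

definition sq_norm_cvec :: "complex vec \<Rightarrow> real" where
  "sq_norm_cvec v = (\<Sum>i<dim_vec v. (cmod (v $ i))\<^sup>2)"

lemma cscalar_prod_self: "v \<bullet>c v = complex_of_real (sq_norm_cvec v)"
  by (simp add: sq_norm_cvec_def scalar_prod_def atLeast0LessThan complex_norm_square[symmetric]
           del: of_real_power)

lemma sq_norm_cvec_nonneg: "sq_norm_cvec v \<ge> 0"
  by (simp add: sq_norm_cvec_def sum_nonneg)

lemma sq_norm_cvec_eq_0_iff: "v \<in> carrier_vec n \<Longrightarrow> sq_norm_cvec v = 0 \<longleftrightarrow> v = 0\<^sub>v n"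
  using cscalar_prod_self[of v] conjugate_square_eq_0_vec[of v n] by simp

text \<open>Pythagoras: the mixed term of the expansion is twice the real part of
  \<open>c * (b \<bullet>c a)\<close>.\<close>

lemma sq_norm_cvec_add_orthogonal:
  assumes a: "a \<in> carrier_vec n" and b: "b \<in> carrier_vec n" and ab: "b \<bullet>c a = 0"
  shows "sq_norm_cvec (a + c \<cdot>\<^sub>v b) = sq_norm_cvec a + (cmod c)\<^sup>2 * sq_norm_cvec b"
proof -
  have "(\<Sum>i<n. b $ i * cnj (a $ i)) = 0"
    using a b ab by (simp add: scalar_prod_def atLeast0LessThan)
  moreover have "(\<Sum>i<n. (cmod (a $ i + c * b $ i))\<^sup>2) =
      (\<Sum>i<n. (cmod (a $ i))\<^sup>2 + (cmod c)\<^sup>2 * (cmod (b $ i))\<^sup>2 + 2 * Re (c * (b $ i * cnj (a $ i))))"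
    by (intro sum.cong refl) (simp only: cmod_power2, simp add: power2_eq_square algebra_simps)
  ultimately show ?thesis
    using a b
    by (simp add: sq_norm_cvec_def sum.distrib sum_distrib_left[symmetric] Re_sum[symmetric]
             del: Re_sum times_complex.sel)
qed

lemma index_mat_adjoint:
  "i < dim_col A \<Longrightarrow> j < dim_row A \<Longrightarrow> mat_adjoint A $$ (i, j) = conjugate (A $$ (j, i))"
  by (simp add: mat_adjoint_def mat_of_rows_index)

lemma mat_adjoint_carrier: "A \<in> carrier_mat nr nc \<Longrightarrow> mat_adjoint A \<in> carrier_mat nc nr"
  unfolding mat_adjoint_def carrier_mat_def by simp

lemma mult_mat_vec_cscalar:
  fixes A :: "complex mat"
  assumes A: "A \<in> carrier_mat nr nc" and v: "v \<in> carrier_vec nc" and w: "w \<in> carrier_vec nr"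
  shows "(A *\<^sub>v v) \<bullet>c w = v \<bullet>c (mat_adjoint A *\<^sub>v w)"
proof -
  have "(A *\<^sub>v v) \<bullet>c w = (\<Sum>i<nr. \<Sum>j<nc. A $$ (i,j) * v $ j * cnj (w $ i))"
    using A v w by (simp add: scalar_prod_def atLeast0LessThan sum_distrib_right)
  also have "\<dots> = (\<Sum>j<nc. \<Sum>i<nr. A $$ (i,j) * v $ j * cnj (w $ i))"
    by (rule sum.swap)
  also have "\<dots> = v \<bullet>c (mat_adjoint A *\<^sub>v w)"
    using A v w mat_adjoint_carrier[OF A]
    by (simp add: scalar_prod_def atLeast0LessThan sum_distrib_left index_mat_adjoint mult_ac)
  finally show ?thesis .
qed

lemma mult_mat_vec_cscalar_right:
  fixes A :: "complex mat"
  assumes A: "A \<in> carrier_mat nr nc" and v: "v \<in> carrier_vec nr" and w: "w \<in> carrier_vec nc"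
  shows "v \<bullet>c (A *\<^sub>v w) = (mat_adjoint A *\<^sub>v v) \<bullet>c w"
proof -
  have "mat_adjoint (mat_adjoint A) = A"
    using mat_adjoint_carrier[OF A] mat_adjoint_carrier[OF mat_adjoint_carrier[OF A]] A
    by (intro eq_matI) (auto simp: index_mat_adjoint)
  then show ?thesis
    using mult_mat_vec_cscalar[OF mat_adjoint_carrier[OF A] v w] by simp
qed

lemma obtain_vec_of_support_orthogonal:
  fixes f :: "nat \<Rightarrow> 'a::field vec"
  assumes k: "k < n" and f: "\<And>l. l < k \<Longrightarrow> f l \<in> carrier_vec n"
  obtains y where "y \<in> carrier_vec n" "y \<noteq> 0\<^sub>v n"
    "\<And>i. Suc k \<le> i \<Longrightarrow> i < n \<Longrightarrow> y $ i = 0" "\<And>l. l < k \<Longrightarrow> f l \<bullet> y = 0"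
proof -
  define c where "c = (\<lambda>i. if i < k then f i else unit_vec n i)"
  \<comment> \<open>Rows of index less than \<open>k\<close> impose the given equations, rows of
    index greater than \<open>k\<close> kill the surplus coordinates, and the zero row in between
    makes the matrix singular.\<close>
  define M where "M = mat\<^sub>r n n (\<lambda>i. if i = k then 0\<^sub>v n else c i)"
  have c: "c \<in> {0..<n} \<rightarrow> carrier_vec n"
    using f by (auto simp: c_def)
  have "det M = 0" unfolding M_def by (rule det_row_0[OF k c])
  moreover have M: "M \<in> carrier_mat n n" by (simp add: M_def)
  ultimately obtain y where y: "y \<in> carrier_vec n" "y \<noteq> 0\<^sub>v n" "M *\<^sub>v y = 0\<^sub>v n"
    using det_0_iff_vec_prod_zero_field[OF M] by auto
  have *: "c i \<bullet> y = 0" if "i < n" "i \<noteq> k" for i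
  proof -
    have "row M i = c i"
      using that c by (intro eq_vecI) (auto simp: M_def Pi_iff)
    then show ?thesis
      using that M y(3) by (metis carrier_matD(1) index_mult_mat_vec index_zero_vec(1))
  qed
  show ?thesis
  proof
    show "y $ i = 0" if "Suc k \<le> i" "i < n" for i
      using *[of i] that y(1) by (simp add: c_def)
    show "f l \<bullet> y = 0" if "l < k" for l
      using *[of l] that k by (simp add: c_def)
  qed (use y in auto)
qed

text \<open>This is the invariance of the standard coordinate flag under \<open>B\<close>.\<close>

lemma upper_triangular_mult_support:
  fixes B :: "'a::field mat"
  assumes B: "B \<in> carrier_mat n n" "upper_triangular B" and y: "y \<in> carrier_vec n"
    and supp: "\<And>i. k \<le> i \<Longrightarrow> i < n \<Longrightarrow> y $ i = 0" and i: "k \<le> i" "i < n"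
  shows "(B *\<^sub>v y) $ i = 0"
proof -
  have "B $$ (i, j) * y $ j = 0" if "j < n" for j
    using B supp[of j] i that by (cases "j < i") auto
  then show ?thesis
    using B(1) y i by (auto simp: scalar_prod_def intro!: sum.neutral)
qed

text \<open>On the quotient of two consecutive flag spaces \<open>B\<close> acts as its diagonal
  entry; every other term of row \<open>k\<close> is killed by \<open>B\<close> or by
  \<open>y\<close>.\<close>

lemma upper_triangular_mult_last:
  fixes B :: "'a::field mat"
  assumes B: "B \<in> carrier_mat n n" "upper_triangular B" and y: "y \<in> carrier_vec n"
    and supp: "\<And>i. Suc k \<le> i \<Longrightarrow> i < n \<Longrightarrow> y $ i = 0" and k: "k < n"
  shows "(B *\<^sub>v y) $ k = B $$ (k, k) * y $ k"
proof -
  have "B $$ (k, j) * y $ j = (if j = k then B $$ (k, k) * y $ k else 0)" if "j < n" for j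
    using B supp[of j] k that by (cases "j < k") auto
  then have "(\<Sum>j<n. B $$ (k, j) * y $ j) = (\<Sum>j<n. if j = k then B $$ (k, k) * y $ k else 0)"
    by (intro sum.cong) auto
  then show ?thesis
    using B(1) y k by (simp add: scalar_prod_def atLeast0LessThan)
qed

text \<open>
  The vector \<open>q\<close> in the induction step lies in the \<open>k\<close>-th space of the \<open>H\<close>-invariant flag spanned by
  the columns of \<open>P\<close> and is orthogonal to the preceding one. As \<open>H\<close> is Hermitian, \<open>(H - \<lambda>\<^sub>k) P q\<close> lies in
  that preceding space and is orthogonal to it, hence vanishes: \<open>P q\<close> is an eigenvector, and the
  bound follows from Pythagoras.
\<close>
lemma hermitian_flag_lower_bound:
  fixes H B P :: "complex mat"
  assumes H: "H \<in> carrier_mat n n" "mat_adjoint H = H"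
    and B: "B \<in> carrier_mat n n" "upper_triangular B"
    and P: "P \<in> carrier_mat n n" and HP: "H * P = P * B"
    and inj: "\<And>y. y \<in> carrier_vec n \<Longrightarrow> P *\<^sub>v y = 0\<^sub>v n \<Longrightarrow> y = 0\<^sub>v n"
    and m: "m \<ge> 0" "\<And>i. i < k \<Longrightarrow> m \<le> cmod (B $$ (i, i))" and k: "k \<le> n"
    and y: "y \<in> carrier_vec n" "\<And>i. k \<le> i \<Longrightarrow> i < n \<Longrightarrow> y $ i = 0"
  shows "m\<^sup>2 * sq_norm_cvec (P *\<^sub>v y) \<le> sq_norm_cvec (H *\<^sub>v (P *\<^sub>v y))"
  using m k y
proof (induction k arbitrary: y)
  case 0
  then have "y = 0\<^sub>v n" by (intro eq_vecI) auto
  then have "P *\<^sub>v y = 0\<^sub>v n" using P by (intro eq_vecI) auto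
  then have "m\<^sup>2 * sq_norm_cvec (P *\<^sub>v y) = 0" by (simp add: sq_norm_cvec_def)
  then show ?case using sq_norm_cvec_nonneg[of "H *\<^sub>v (P *\<^sub>v y)"] by linarith
next
  case (Suc k)
  have kn: "k < n" using Suc.prems(3) by simp
  have HPB: "H *\<^sub>v (P *\<^sub>v x) = P *\<^sub>v (B *\<^sub>v x)" if "x \<in> carrier_vec n" for x
    using HP assoc_mult_mat_vec[OF H(1) P that] assoc_mult_mat_vec[OF P B(1) that] by simp
  \<comment> \<open>\<open>G\<close> is the Gram matrix of the columns of \<open>P\<close>. Its
    first \<open>k\<close> rows turn orthogonality of \<open>P *\<^sub>v q\<close> to the first
    \<open>k\<close> columns into linear equations for \<open>q\<close>.\<close>
  define G where "G = mat_adjoint P * P"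
  have G: "G \<in> carrier_mat n n"
    using P mat_adjoint_carrier[OF P] by (auto simp: G_def)
  have rowG: "row G l \<in> carrier_vec n" for l
    using G by auto
  obtain q where q: "q \<in> carrier_vec n" "q \<noteq> 0\<^sub>v n"
      "\<And>i. Suc k \<le> i \<Longrightarrow> i < n \<Longrightarrow> q $ i = 0" "\<And>l. l < k \<Longrightarrow> row G l \<bullet> q = 0"
    using obtain_vec_of_support_orthogonal[OF kn, of "row G"] rowG by blast
  have Pc: "P *\<^sub>v x \<in> carrier_vec n" if "x \<in> carrier_vec n" for x
    using P that by simp
  have Bc: "B *\<^sub>v x \<in> carrier_vec n" if "x \<in> carrier_vec n" for x
    using B(1) that by simp
  have orth: "(P *\<^sub>v q) \<bullet>c (P *\<^sub>v u) = 0"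
    if u: "u \<in> carrier_vec n" "\<And>i. k \<le> i \<Longrightarrow> i < n \<Longrightarrow> u $ i = 0" for u
  proof -
    have "(P *\<^sub>v q) \<bullet>c (P *\<^sub>v u) = (G *\<^sub>v q) \<bullet>c u"
      using mult_mat_vec_cscalar_right[OF P Pc[OF q(1)] u(1)] P q(1) mat_adjoint_carrier[OF P]
      by (simp add: G_def)
    also have "\<dots> = (\<Sum>i<n. (row G i \<bullet> q) * cnj (u $ i))"
      using G q(1) u(1) by (simp add: scalar_prod_def[of "G *\<^sub>v q"] atLeast0LessThan)
    also have "\<dots> = 0"
      using q(4) u(2) by (intro sum.neutral) (metis complex_cnj_zero lessThan_iff mult_zero_left mult_zero_right not_le)
    finally show ?thesis .
  qed
  define r where "r = B *\<^sub>v q - B $$ (k, k) \<cdot>\<^sub>v q"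
  have r: "r \<in> carrier_vec n" using Bc q(1) by (simp add: r_def)
  have r_supp: "r $ i = 0" if "k \<le> i" "i < n" for i
    using upper_triangular_mult_support[OF B q(1) q(3), of i]
      upper_triangular_mult_last[OF B q(1) q(3) kn] q(1,3) Bc[OF q(1)] that B(1)
    by (cases "i = k") (auto simp: r_def)
  have Pr: "P *\<^sub>v r = H *\<^sub>v (P *\<^sub>v q) - B $$ (k, k) \<cdot>\<^sub>v (P *\<^sub>v q)"
    using P Bc[OF q(1)] q(1) by (simp add: r_def HPB mult_minus_distrib_mat_vec mult_mat_vec)
  \<comment> \<open>The vector is shown to be orthogonal to itself: \<open>H\<close> moves to the
    other factor, and \<open>B *\<^sub>v r\<close> still has support below \<open>k\<close>.\<close>
  have "(P *\<^sub>v r) \<bullet>c (P *\<^sub>v r) =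
      (H *\<^sub>v (P *\<^sub>v q)) \<bullet>c (P *\<^sub>v r) - B $$ (k, k) * ((P *\<^sub>v q) \<bullet>c (P *\<^sub>v r))"
    using Pc[OF r] Pc[OF q(1)] H(1) P
    by (subst Pr) (simp add: minus_scalar_prod_distrib[of _ n])
  also have "\<dots> = (P *\<^sub>v q) \<bullet>c (P *\<^sub>v (B *\<^sub>v r))"
    using mult_mat_vec_cscalar[OF H(1) Pc[OF q(1)] Pc[OF r]] orth[OF r r_supp]
    by (simp add: H(2) HPB[OF r])
  also have "\<dots> = 0"
    using orth[OF Bc[OF r]] upper_triangular_mult_support[OF B r r_supp] by blast
  finally have Pr0: "P *\<^sub>v r = 0\<^sub>v n"
    using Pc[OF r] conjugate_square_eq_0_vec by blast
  have Hq: "H *\<^sub>v (P *\<^sub>v q) = B $$ (k, k) \<cdot>\<^sub>v (P *\<^sub>v q)"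
  proof (rule eq_vecI)
    fix i assume "i < dim_vec (B $$ (k, k) \<cdot>\<^sub>v (P *\<^sub>v q))"
    then have i: "i < n" using P by simp
    have "(H *\<^sub>v (P *\<^sub>v q) - B $$ (k, k) \<cdot>\<^sub>v (P *\<^sub>v q)) $ i = 0"
      using Pr[unfolded Pr0] i by (metis index_zero_vec(1))
    then show "(H *\<^sub>v (P *\<^sub>v q)) $ i = (B $$ (k, k) \<cdot>\<^sub>v (P *\<^sub>v q)) $ i"
      using i P H(1) by simp
  qed (use P H(1) in simp)
  \<comment> \<open>Otherwise \<open>P *\<^sub>v q\<close> would lie in the space to which it is
    orthogonal and would be zero, against injectivity.\<close>
  have qk: "q $ k \<noteq> 0"
  proof
    assume "q $ k = 0"
    then have "q $ i = 0" if "k \<le> i" "i < n" for i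
      using q(3) that by (cases "i = k") auto
    then have "(P *\<^sub>v q) \<bullet>c (P *\<^sub>v q) = 0" using orth[OF q(1)] by blast
    then have "P *\<^sub>v q = 0\<^sub>v n" using Pc[OF q(1)] conjugate_square_eq_0_vec by blast
    then show False using inj q(1,2) by blast
  qed
  \<comment> \<open>This multiple of \<open>q\<close> cancels coordinate \<open>k\<close> of
    \<open>y\<close>, so the remainder \<open>u\<close> falls under the induction
    hypothesis.\<close>
  define c where "c = y $ k / q $ k"
  define u where "u = y - c \<cdot>\<^sub>v q"
  have u: "u \<in> carrier_vec n" using Suc.prems q(1) by (simp add: u_def)
  have u_supp: "u $ i = 0" if "k \<le> i" "i < n" for i
    using that Suc.prems(5)[of i] q(3)[of i] qk Suc.prems(4) q(1)
    by (cases "i = k") (auto simp: u_def c_def)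
  have "y = u + c \<cdot>\<^sub>v q"
    using Suc.prems q(1) by (intro eq_vecI) (auto simp: u_def)
  then have Py: "P *\<^sub>v y = P *\<^sub>v u + c \<cdot>\<^sub>v (P *\<^sub>v q)"
    using P u q(1) by (simp add: mult_add_distrib_mat_vec mult_mat_vec)
  then have "H *\<^sub>v (P *\<^sub>v y) = P *\<^sub>v (B *\<^sub>v u) + c \<cdot>\<^sub>v (B $$ (k, k) \<cdot>\<^sub>v (P *\<^sub>v q))"
    using H(1) Pc[OF u] Pc[OF q(1)] by (simp add: mult_add_distrib_mat_vec mult_mat_vec HPB[OF u] Hq)
  then have HPy: "H *\<^sub>v (P *\<^sub>v y) = P *\<^sub>v (B *\<^sub>v u) + (c * B $$ (k, k)) \<cdot>\<^sub>v (P *\<^sub>v q)"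
    by (simp add: smult_smult_assoc)
  have "m\<^sup>2 * sq_norm_cvec (P *\<^sub>v y) =
      m\<^sup>2 * sq_norm_cvec (P *\<^sub>v u) + (cmod c)\<^sup>2 * (m\<^sup>2 * sq_norm_cvec (P *\<^sub>v q))"
    unfolding Py using sq_norm_cvec_add_orthogonal[OF Pc[OF u] Pc[OF q(1)] orth[OF u u_supp]]
    by (simp add: algebra_simps)
  also have "\<dots> \<le> sq_norm_cvec (H *\<^sub>v (P *\<^sub>v u)) +
      (cmod c)\<^sup>2 * ((cmod (B $$ (k, k)))\<^sup>2 * sq_norm_cvec (P *\<^sub>v q))"
    using Suc.IH[OF Suc.prems(1) Suc.prems(2) _ u u_supp] Suc.prems(1) Suc.prems(2)[of k] kn
    by (intro add_mono mult_left_mono mult_right_mono power_mono sq_norm_cvec_nonneg) auto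
  also have "\<dots> = sq_norm_cvec (H *\<^sub>v (P *\<^sub>v y))"
  proof -
    have "(P *\<^sub>v q) \<bullet>c (P *\<^sub>v (B *\<^sub>v u)) = 0"
      using orth[OF Bc[OF u]] upper_triangular_mult_support[OF B u u_supp] by blast
    then show ?thesis
      unfolding HPy HPB[OF u]
      using sq_norm_cvec_add_orthogonal[OF Pc[OF Bc[OF u]] Pc[OF q(1)]]
      by (simp add: norm_mult power_mult_distrib)
  qed
  finally show ?case .
qed

text \<open>A crude operator norm bound, by Cauchy-Schwarz in each row. What matters later is that
  the constant depends on \<open>n\<close> and \<open>C\<close> alone.\<close>

lemma sq_norm_mult_mat_vec_le:
  fixes M :: "complex mat"
  assumes M: "M \<in> carrier_mat n n" and v: "v \<in> carrier_vec n"
    and C: "\<And>i j. i < n \<Longrightarrow> j < n \<Longrightarrow> cmod (M $$ (i, j)) \<le> C"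
  shows "sq_norm_cvec (M *\<^sub>v v) \<le> (real n * C)\<^sup>2 * sq_norm_cvec v"
proof -
  have "(cmod ((M *\<^sub>v v) $ i))\<^sup>2 \<le> real n * C\<^sup>2 * sq_norm_cvec v" if i: "i < n" for i
  proof -
    have "cmod ((M *\<^sub>v v) $ i) \<le> (\<Sum>j<n. cmod (M $$ (i, j) * v $ j))"
      using M v i by (simp add: scalar_prod_def atLeast0LessThan norm_sum)
    also have "\<dots> \<le> (\<Sum>j<n. C * cmod (v $ j))"
      using C i by (intro sum_mono) (simp add: norm_mult mult_right_mono)
    finally have "(cmod ((M *\<^sub>v v) $ i))\<^sup>2 \<le> (\<Sum>j<n. C * cmod (v $ j))\<^sup>2"
      by (intro power_mono) auto
    also have "\<dots> \<le> (\<Sum>j<n. (C * cmod (v $ j))\<^sup>2) * real (card {..<n})"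
      using sum_squared_le_sum_of_squares[of "\<lambda>j. C * cmod (v $ j)" "{..<n}"] by simp
    also have "\<dots> = real n * C\<^sup>2 * sq_norm_cvec v"
      using v by (simp add: sq_norm_cvec_def power_mult_distrib sum_distrib_left[symmetric])
    finally show ?thesis .
  qed
  moreover have "sq_norm_cvec (M *\<^sub>v v) = (\<Sum>i<n. (cmod ((M *\<^sub>v v) $ i))\<^sup>2)"
    using M by (simp add: sq_norm_cvec_def)
  ultimately have "sq_norm_cvec (M *\<^sub>v v) \<le> (\<Sum>i<n. real n * C\<^sup>2 * sq_norm_cvec v)"
    by (simp only:) (intro sum_mono, simp only: lessThan_iff)
  also have "\<dots> = (real n * C)\<^sup>2 * sq_norm_cvec v"
    by (simp add: power2_eq_square)
  finally show ?thesis .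
qed

section \<open>Schur form and comparison with the diagonal factor\<close>

text \<open>The Schur decomposition allows any order of the eigenvalues along the diagonal. The
  order of \<open>l\<close> is kept, since the leading diagonal entries control the leading flag
  spaces.\<close>

lemma schur_triangular_real_roots:
  fixes H :: "complex mat" and l :: "nat \<Rightarrow> real"
  assumes H: "H \<in> carrier_mat n n"
    and cp: "char_poly H = (\<Prod>j<n. [:- complex_of_real (l j), 1:])"
  obtains B P Q where "similar_mat_wit H B P Q" "upper_triangular B"
    "\<And>i. i < n \<Longrightarrow> B $$ (i, i) = complex_of_real (l i)"
proof -
  define es where "es = map (\<lambda>j. complex_of_real (l j)) [0..<n]"
  obtain B P Q where BPQ: "schur_decomposition H es = (B, P, Q)"
    by (cases "schur_decomposition H es") auto
  have "char_poly H = (\<Prod>e\<leftarrow>es. [:- e, 1:])"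
    unfolding cp es_def map_map comp_def
    by (subst prod.distinct_set_conv_list[symmetric]) (auto simp: atLeast0LessThan)
  from schur_decomposition[OF H this BPQ]
  have sim: "similar_mat_wit H B P Q" and ut: "upper_triangular B" and diag: "diag_mat B = es"
    by auto
  have "B \<in> carrier_mat n n" using similar_mat_witD2[OF H sim] by simp
  then have "B $$ (i, i) = complex_of_real (l i)" if "i < n" for i
    using arg_cong[OF diag, of "\<lambda>xs. xs ! i"] that by (simp add: diag_mat_def es_def)
  with sim ut show ?thesis using that by blast
qed

lemma det_eq_prod_roots:
  fixes H :: "complex mat" and l :: "nat \<Rightarrow> real"
  assumes H: "H \<in> carrier_mat n n"
    and cp: "char_poly H = (\<Prod>j<n. [:- complex_of_real (l j), 1:])"
  shows "det H = (\<Prod>j<n. complex_of_real (l j))"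
proof -
  obtain B P Q where B: "similar_mat_wit H B P Q" "upper_triangular B"
      "\<And>i. i < n \<Longrightarrow> B $$ (i, i) = complex_of_real (l i)"
    using schur_triangular_real_roots[OF H cp] by blast
  have Bc: "B \<in> carrier_mat n n" using similar_mat_witD2[OF H B(1)] by simp
  have "det H = det B"
    using B(1) det_similar unfolding similar_mat_def by blast
  also have "\<dots> = (\<Prod>i = 0..<n. B $$ (i, i))"
    using det_upper_triangular[OF B(2) Bc] Bc by (simp add: prod_list_diag_prod)
  also have "\<dots> = (\<Prod>j<n. complex_of_real (l j))"
    using B(3) by (simp add: atLeast0LessThan)
  finally show ?thesis .
qed

text \<open>A minimax argument at a single point. A nonzero \<open>v\<close> is taken in the flag
  space of the first \<open>j + 1\<close> diagonal entries such that the first \<open>j\<close>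
  coordinates of \<open>F *\<^sub>v v\<close> vanish. Then \<open>H\<close> stretches
  \<open>v\<close> by at least \<open>m\<close>, whereas the factorization only sees the
  \<open>\<delta> i\<close> with \<open>j \<le> i\<close>.\<close>

lemma hermitian_factorization_bound:
  fixes H E F :: "complex mat" and l :: "nat \<Rightarrow> real"
  assumes H: "H \<in> carrier_mat n n" "mat_adjoint H = H"
    and cp: "char_poly H = (\<Prod>j<n. [:- complex_of_real (l j), 1:])"
    and E: "E \<in> carrier_mat n n" "\<And>i j. i < n \<Longrightarrow> j < n \<Longrightarrow> cmod (E $$ (i, j)) \<le> CE"
    and F: "F \<in> carrier_mat n n" "\<And>i j. i < n \<Longrightarrow> j < n \<Longrightarrow> cmod (F $$ (i, j)) \<le> CF"
    and fact: "H = E * mat n n (\<lambda>(i, j). if i = j then \<delta> i else 0) * F"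
    and j: "j < n" and m: "m \<ge> 0" "\<And>i. i \<le> j \<Longrightarrow> m \<le> \<bar>l i\<bar>"
    and M: "\<And>i. j \<le> i \<Longrightarrow> i < n \<Longrightarrow> cmod (\<delta> i) \<le> M"
  shows "m \<le> (real n * CE) * M * (real n * CF)"
proof -
  define D where "D = mat n n (\<lambda>(i, j). if i = j then \<delta> i else 0)"
  have D: "D \<in> carrier_mat n n" by (simp add: D_def)
  obtain B P Q where B: "similar_mat_wit H B P Q" "upper_triangular B"
      "\<And>i. i < n \<Longrightarrow> B $$ (i, i) = complex_of_real (l i)"
    using schur_triangular_real_roots[OF H(1) cp] by blast
  note sim = similar_mat_witD2[OF H(1) B(1)]
  have HP: "H * P = P * B"
  proof -
    have "H * P = P * B * (Q * P)"
      using sim by (simp add: assoc_mult_mat[of _ n n _ n _ n])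
    then show ?thesis using sim by simp
  qed
  have inj: "y = 0\<^sub>v n" if "y \<in> carrier_vec n" "P *\<^sub>v y = 0\<^sub>v n" for y
  proof -
    have "y = (Q * P) *\<^sub>v y" using sim that(1) by simp
    also have "\<dots> = Q *\<^sub>v (P *\<^sub>v y)" using sim that(1) by (intro assoc_mult_mat_vec)
    also have "\<dots> = 0\<^sub>v n" using sim(7) unfolding that(2) by (intro eq_vecI) auto
    finally show ?thesis .
  qed
  have FP: "F * P \<in> carrier_mat n n" using F(1) sim(6) by simp
  have "row (F * P) i \<in> carrier_vec n" for i
    using sim(6) by (intro carrier_vecI) simp
  \<comment> \<open>The unknowns are the coefficients with respect to the columns of
    \<open>P\<close>: \<open>j\<close> equations for \<open>j + 1\<close> of them.\<close>
  then obtain y where y: "y \<in> carrier_vec n" "y \<noteq> 0\<^sub>v n"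
      "\<And>i. Suc j \<le> i \<Longrightarrow> i < n \<Longrightarrow> y $ i = 0" "\<And>i. i < j \<Longrightarrow> row (F * P) i \<bullet> y = 0"
    using obtain_vec_of_support_orthogonal[OF j, of "row (F * P)"] by blast
  define v where "v = P *\<^sub>v y"
  have v: "v \<in> carrier_vec n" using sim(6) y(1) by (simp add: v_def)
  have v0: "sq_norm_cvec v > 0"
    using inj y(1,2) sq_norm_cvec_nonneg[of v] sq_norm_cvec_eq_0_iff[OF v] by (force simp: v_def)
  have Fv: "F *\<^sub>v v \<in> carrier_vec n" using F(1) v by simp
  have Fv0: "(F *\<^sub>v v) $ i = 0" if "i < j" for i
  proof -
    have "F *\<^sub>v v = (F * P) *\<^sub>v y"
      unfolding v_def using F(1) sim(6) y(1) by (intro assoc_mult_mat_vec[symmetric])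
    then show ?thesis using y(4)[OF that] that j F(1) by simp
  qed
  have D_mult: "(D *\<^sub>v w) $ i = \<delta> i * w $ i" if "w \<in> carrier_vec n" "i < n" for w i
  proof -
    have "(D *\<^sub>v w) $ i = (\<Sum>k<n. (if i = k then \<delta> i else 0) * w $ k)"
      using that by (simp add: D_def scalar_prod_def atLeast0LessThan)
    also have "\<dots> = (\<Sum>k<n. if i = k then \<delta> i * w $ i else 0)"
      by (intro sum.cong) auto
    finally show ?thesis using that by simp
  qed
  note DFv = D_mult[OF Fv]
  have M0: "M \<ge> 0" using order_trans[OF norm_ge_zero M[of j]] j by simp
  have "sq_norm_cvec (D *\<^sub>v (F *\<^sub>v v)) \<le> M\<^sup>2 * sq_norm_cvec (F *\<^sub>v v)"
  proof -
    have "(cmod ((D *\<^sub>v (F *\<^sub>v v)) $ i))\<^sup>2 \<le> M\<^sup>2 * (cmod ((F *\<^sub>v v) $ i))\<^sup>2" if "i < n" for i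
    proof (cases "i < j")
      case True
      then show ?thesis using DFv[OF that] Fv0 by simp
    next
      case False
      then show ?thesis
        unfolding DFv[OF that] norm_mult power_mult_distrib
        using M[of i] that by (intro mult_right_mono power_mono) auto
    qed
    then have "(\<Sum>i<n. (cmod ((D *\<^sub>v (F *\<^sub>v v)) $ i))\<^sup>2) \<le> (\<Sum>i<n. M\<^sup>2 * (cmod ((F *\<^sub>v v) $ i))\<^sup>2)"
      by (intro sum_mono) (simp only: lessThan_iff)
    moreover have "dim_vec (D *\<^sub>v (F *\<^sub>v v)) = n" "dim_vec (F *\<^sub>v v) = n"
      using D F(1) by simp_all
    ultimately show ?thesis
      by (simp only: sq_norm_cvec_def sum_distrib_left)
  qed
  also have "\<dots> \<le> M\<^sup>2 * ((real n * CF)\<^sup>2 * sq_norm_cvec v)"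
    using sq_norm_mult_mat_vec_le[OF F(1) v F(2)] by (intro mult_left_mono) auto
  finally have "sq_norm_cvec (D *\<^sub>v (F *\<^sub>v v)) \<le> M\<^sup>2 * ((real n * CF)\<^sup>2 * sq_norm_cvec v)" .
  moreover have "H *\<^sub>v v = E *\<^sub>v (D *\<^sub>v (F *\<^sub>v v))"
  proof -
    have "H *\<^sub>v v = (E * D) *\<^sub>v (F *\<^sub>v v)"
      unfolding fact D_def[symmetric] using E(1) D F(1) v by (intro assoc_mult_mat_vec) auto
    also have "\<dots> = E *\<^sub>v (D *\<^sub>v (F *\<^sub>v v))"
      using E(1) D Fv by (intro assoc_mult_mat_vec)
    finally show ?thesis .
  qed
  moreover have "sq_norm_cvec (E *\<^sub>v (D *\<^sub>v (F *\<^sub>v v))) \<le> (real n * CE)\<^sup>2 * sq_norm_cvec (D *\<^sub>v (F *\<^sub>v v))"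
    using D Fv by (intro sq_norm_mult_mat_vec_le[OF E(1) _ E(2)]) auto
  ultimately have "sq_norm_cvec (H *\<^sub>v v) \<le> (real n * CE)\<^sup>2 * (M\<^sup>2 * ((real n * CF)\<^sup>2 * sq_norm_cvec v))"
    using mult_left_mono[of _ _ "(real n * CE)\<^sup>2"] by (smt (verit) zero_le_power2)
  moreover have "m\<^sup>2 * sq_norm_cvec v \<le> sq_norm_cvec (H *\<^sub>v v)"
    unfolding v_def
    using hermitian_flag_lower_bound[OF H sim(5) B(2) sim(6) HP inj m(1), of "Suc j" y] m(2) B(3) j y
    by auto
  ultimately have "m\<^sup>2 * sq_norm_cvec v \<le> ((real n * CE) * M * (real n * CF))\<^sup>2 * sq_norm_cvec v"
    by (simp add: power_mult_distrib mult_ac)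
  then have sq: "m\<^sup>2 \<le> ((real n * CE) * M * (real n * CF))\<^sup>2"
    using v0 by (simp add: mult_le_cancel_right)
  \<comment> \<open>Each bound dominates the modulus of the entry at \<open>(j, j)\<close>.
    Nonnegativity permits taking square roots.\<close>
  have "CE \<ge> 0" "CF \<ge> 0"
    using order_trans[OF norm_ge_zero E(2)[OF j j]] order_trans[OF norm_ge_zero F(2)[OF j j]]
    by simp_all
  then have "0 \<le> (real n * CE) * M * (real n * CF)"
    using M0 by (intro mult_nonneg_nonneg) simp_all
  with sq show ?thesis by (rule power2_le_imp_le)
qed

subsection \<open>Evaluation of Laurent polynomials\<close>

text \<open>Supports change under ring operations; a larger index set allows several polynomials to
  be summed over one common set.\<close>

lemma leval_eq_sum:
  assumes "finite S" "Poly_Mapping.keys p \<subseteq> S"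
  shows "leval p z = (\<Sum>k\<in>S. Poly_Mapping.lookup p k * z powi k)"
  unfolding leval_def
  by (rule sum.mono_neutral_left) (use assms in \<open>auto simp: in_keys_iff\<close>)

lemma leval_add: "leval (p + q) z = leval p z + leval q z"
proof -
  define S where "S = Poly_Mapping.keys p \<union> Poly_Mapping.keys q"
  have "finite S" "Poly_Mapping.keys (p + q) \<subseteq> S" "Poly_Mapping.keys p \<subseteq> S" "Poly_Mapping.keys q \<subseteq> S"
    using Poly_Mapping.keys_add[of p q] by (auto simp: S_def)
  then show ?thesis
    by (simp add: leval_eq_sum[of S] lookup_add algebra_simps sum.distrib)
qed

lemma leval_0: "leval 0 z = 0"
  by (simp add: leval_def)

lemma leval_single: "leval (Poly_Mapping.single k c) z = c * z powi k"
  by (simp add: leval_def)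

text \<open>Every finitely supported function is a finite sum of monomials, so an identity additive
  in \<open>f\<close> need only be checked on these.\<close>

lemma poly_mapping_add_single_induct [case_names zero add_single]:
  assumes "P 0" and "\<And>f a b. P f \<Longrightarrow> P (f + Poly_Mapping.single a b)"
  shows "P f"
proof (induction f rule: update_induct)
  case const
  show ?case by fact
next
  case (update f a b)
  have "Poly_Mapping.update a b f = f + Poly_Mapping.single a b"
    using update.hyps
    by (intro poly_mapping_eqI) (auto simp: lookup_update lookup_add lookup_single in_keys_iff when_def)
  then show ?case using assms(2)[OF update.IH] by simp
qed

text \<open>Both sides are additive in each factor, and for monomials the claim is the addition rule
  for integer exponents, which requires \<open>z \<noteq> 0\<close>.\<close>

lemma leval_mult:
  assumes "z \<noteq> 0"
  shows "leval (p * q) z = leval p z * leval q z"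
proof (induction p rule: poly_mapping_add_single_induct)
  case zero
  show ?case by (simp add: leval_0)
next
  case (add_single f a b)
  have "leval (Poly_Mapping.single a b * q) z = leval (Poly_Mapping.single a b) z * leval q z"
  proof (induction q rule: poly_mapping_add_single_induct)
    case zero
    show ?case by (simp add: leval_0)
  next
    case (add_single g c d)
    then show ?case
      using assms by (simp add: distrib_left leval_add mult_single leval_single power_int_add)
  qed
  then show ?case by (simp add: distrib_right leval_add add_single)
qed

text \<open>This makes evaluation commute with determinants and matrix products.\<close>

lemma comm_ring_hom_leval: "z \<noteq> 0 \<Longrightarrow> comm_ring_hom (\<lambda>p. leval p z)"
  by unfold_locales
     (simp_all add: leval_0 leval_add leval_mult leval_single flip: single_one)

lemma leval_lpoly_of_poly: "leval (lpoly_of_poly p) z = poly p z"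
proof -
  \<comment> \<open>Finite support comes first; only then does \<open>Abs_poly_mapping\<close>
    represent the given coefficient function.\<close>
  have "{k::int. (if k \<ge> 0 then coeff p (nat k) else 0) \<noteq> 0} \<subseteq> int ` {..Polynomial.degree p}"
  proof
    fix k :: int assume "k \<in> {k. (if k \<ge> 0 then coeff p (nat k) else 0) \<noteq> 0}"
    then have "k = int (nat k)" "nat k \<le> Polynomial.degree p"
      by (auto split: if_splits intro: le_degree)
    then show "k \<in> int ` {..Polynomial.degree p}" by blast
  qed
  moreover from this have fin: "finite {k::int. (if k \<ge> 0 then coeff p (nat k) else 0) \<noteq> 0}"
    by (rule finite_subset) simp
  then have lookup: "Poly_Mapping.lookup (lpoly_of_poly p) k = (if k \<ge> 0 then coeff p (nat k) else 0)" for k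
    unfolding lpoly_of_poly_def by (subst Abs_poly_mapping_inverse) simp_all
  ultimately have "Poly_Mapping.keys (lpoly_of_poly p) \<subseteq> int ` {..Polynomial.degree p}"
    by (auto simp: in_keys_iff subset_iff)
  then show ?thesis
    by (subst leval_eq_sum[of "int ` {..Polynomial.degree p}"])
       (auto simp: sum.reindex lookup poly_altdef)
qed

text \<open>All powers of \<open>z\<close> have modulus 1, which makes the bound uniform on the
  circle.\<close>

lemma cmod_leval_le:
  "cmod z = 1 \<Longrightarrow> cmod (leval p z) \<le> (\<Sum>k\<in>Poly_Mapping.keys p. cmod (Poly_Mapping.lookup p k))"
  unfolding leval_def by (rule sum_norm_le) (simp add: norm_mult norm_power_int)

text \<open>On the unit circle \<open>cnj z\<close> is the inverse of \<open>z\<close>, so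
  conjugating the value amounts to reversing the exponents and conjugating the coefficients.\<close>

lemma leval_star:
  assumes z: "cmod z = 1"
  shows "leval (Abs_poly_mapping (\<lambda>k. cnj (Poly_Mapping.lookup p (- k)))) z = cnj (leval p z)"
proof -
  define q where "q = Abs_poly_mapping (\<lambda>k. cnj (Poly_Mapping.lookup p (- k)))"
  have "{k. cnj (Poly_Mapping.lookup p (- k)) \<noteq> 0} = uminus ` Poly_Mapping.keys p"
    by (auto simp: in_keys_iff) (metis image_eqI in_keys_iff minus_minus)
  then have lookup: "Poly_Mapping.lookup q k = cnj (Poly_Mapping.lookup p (- k))" for k
    unfolding q_def by (subst Abs_poly_mapping_inverse) auto
  then have "Poly_Mapping.keys q \<subseteq> uminus ` Poly_Mapping.keys p"
    by (auto simp: in_keys_iff) (metis image_eqI in_keys_iff minus_minus)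
  then have "leval q z = (\<Sum>k\<in>uminus ` Poly_Mapping.keys p. Poly_Mapping.lookup q k * z powi k)"
    by (intro leval_eq_sum) auto
  also have "\<dots> = (\<Sum>k\<in>Poly_Mapping.keys p. cnj (Poly_Mapping.lookup p k) * z powi (- k))"
    by (subst sum.reindex) (auto simp: lookup)
  also have "\<dots> = cnj (leval p z)"
  proof -
    have "z * cnj z = 1" using z complex_norm_square[of z] by simp
    then have "cnj z = inverse z" using inverse_unique by metis
    then show ?thesis
      unfolding leval_def by (simp add: power_int_minus power_int_inverse)
  qed
  finally show ?thesis by (simp add: q_def)
qed

section \<open>Matrices of Laurent polynomials on the unit circle\<close>

lemma lmat_eval_hermite:
  assumes A: "A \<in> carrier_mat n n" and "hermite_lmat A" and z: "cmod z = 1"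
  shows "mat_adjoint (lmat_eval A z) = lmat_eval A z"
proof (rule eq_matI)
  fix i j assume "i < dim_row (lmat_eval A z)" "j < dim_col (lmat_eval A z)"
  then have ij: "i < n" "j < n" using A by (auto simp: lmat_eval_def)
  have "lmat_star A $$ (j, i) = A $$ (j, i)" using assms(2) by (simp add: hermite_lmat_def)
  then have "Abs_poly_mapping (\<lambda>k. cnj (Poly_Mapping.lookup (A $$ (i, j)) (- k))) = A $$ (j, i)"
    using A ij by (simp add: lmat_star_def)
  then have "leval (A $$ (j, i)) z = cnj (leval (A $$ (i, j)) z)"
    using leval_star[OF z, of "A $$ (i, j)"] by simp
  then show "mat_adjoint (lmat_eval A z) $$ (i, j) = lmat_eval A z $$ (i, j)"
    using A ij by (simp add: lmat_eval_def index_mat_adjoint)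
qed (use A mat_adjoint_carrier[of "lmat_eval A z" n n] in \<open>auto simp: lmat_eval_def\<close>)

text \<open>One constant serves all entries and all points of the circle: the sum of the moduli of
  all coefficients of all entries.\<close>

lemma cmod_lmat_eval_bound:
  obtains C where "\<And>z i j. cmod z = 1 \<Longrightarrow> i < dim_row A \<Longrightarrow> j < dim_col A \<Longrightarrow> cmod (lmat_eval A z $$ (i, j)) \<le> C"
proof
  fix z i j assume z: "cmod z = 1" and ij: "i < dim_row A" "j < dim_col A"
  let ?b = "\<lambda>i j. \<Sum>k\<in>Poly_Mapping.keys (A $$ (i, j)). cmod (Poly_Mapping.lookup (A $$ (i, j)) k)"
  have "cmod (lmat_eval A z $$ (i, j)) \<le> ?b i j"
    using cmod_leval_le[OF z] ij by (simp add: lmat_eval_def)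
  also have "\<dots> \<le> (\<Sum>j<dim_col A. ?b i j)"
    using ij by (intro member_le_sum sum_nonneg) auto
  also have "\<dots> \<le> (\<Sum>i<dim_row A. \<Sum>j<dim_col A. ?b i j)"
    using ij by (intro member_le_sum[of i _ "\<lambda>i. \<Sum>j<dim_col A. ?b i j"] sum_nonneg) auto
  finally show "cmod (lmat_eval A z $$ (i, j)) \<le> (\<Sum>i<dim_row A. \<Sum>j<dim_col A. ?b i j)" .
qed

lemma det_lmat_eval: "z \<noteq> 0 \<Longrightarrow> det (lmat_eval A z) = leval (det A) z"
  unfolding lmat_eval_def by (rule comm_ring_hom.hom_det[OF comm_ring_hom_leval])

text \<open>The determinant is a monomial, and monomials have constant modulus on the
  circle.\<close>

lemma cmod_det_unimodular:
  assumes "unimodular_lmat E"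
  obtains c where "c > 0" "\<And>z. cmod z = 1 \<Longrightarrow> cmod (det (lmat_eval E z)) = c"
proof -
  obtain a k where a: "a \<noteq> 0" "det E = Poly_Mapping.single k a"
    using assms by (auto simp: unimodular_lmat_def)
  have "cmod (det (lmat_eval E z)) = cmod a" if "cmod z = 1" for z
  proof -
    have "z \<noteq> 0" using that by auto
    then show ?thesis using that a by (simp add: det_lmat_eval leval_single norm_mult norm_power_int)
  qed
  then show ?thesis using that[of "cmod a"] a by simp
qed

lemma lmat_eval_smith:
  assumes "z \<noteq> 0" "E \<in> carrier_mat n n" "F \<in> carrier_mat n n"
  shows "lmat_eval (E * mat n n (\<lambda>(i, j). if i = j then lpoly_of_poly (d i) else 0) * F) z =
    lmat_eval E z * mat n n (\<lambda>(i, j). if i = j then poly (d i) z else 0) * lmat_eval F z"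
proof -
  interpret comm_ring_hom "\<lambda>p. leval p z" using assms(1) by (rule comm_ring_hom_leval)
  have "map_mat (\<lambda>p. leval p z) (mat n n (\<lambda>(i, j). if i = j then lpoly_of_poly (d i) else 0)) =
      mat n n (\<lambda>(i, j). if i = j then poly (d i) z else 0)"
    by (intro eq_matI) (auto simp: leval_lpoly_of_poly leval_0)
  then show ?thesis
    using assms(2,3) by (simp add: lmat_eval_def mat_hom_mult[of _ n n _ n])
qed

subsection \<open>Order of vanishing\<close>

text \<open>Iterated termwise differentiation. The claim covers all \<open>y\<close> within the
  radius because the next derivative needs a neighbourhood.\<close>

lemma higher_deriv_powser:
  fixes f :: "real \<Rightarrow> real"
  assumes "\<And>y. \<bar>y - x\<bar> < r \<Longrightarrow> (\<lambda>k. c k * (y - x) ^ k) sums f y" and "\<bar>y - x\<bar> < r"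
  shows "(\<lambda>k. (diffs ^^ j) c k * (y - x) ^ k) sums (deriv ^^ j) f y"
  using assms(2)
proof (induction j arbitrary: y)
  case 0
  then show ?case using assms(1) by simp
next
  case (Suc j)
  define g where "g = (deriv ^^ j) f"
  define a where "a = (diffs ^^ j) c"
  have g: "(\<lambda>k. a k * z ^ k) sums g (x + z)" if "norm z < r" for z
    using Suc.IH[of "x + z"] that by (simp add: g_def a_def)
  have y: "norm (y - x) < r" using Suc.prems by simp
  have d: "((\<lambda>z. suminf (\<lambda>k. a k * z ^ k)) has_field_derivative (suminf (\<lambda>k. diffs a k * (y - x) ^ k))) (at (y - x))"
    by (rule termdiffs_strong'[OF _ y]) (use g sums_summable in blast)
  have ev: "\<forall>\<^sub>F z in nhds (y - x). (suminf (\<lambda>k. a k * z ^ k)) = g (x + z)"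
    using eventually_nhds_in_open[of "ball 0 r" "y - x"] y
    by (auto elim!: eventually_mono intro!: sums_unique[symmetric] g)
  have der: "((\<lambda>z. g (x + z)) has_field_derivative (suminf (\<lambda>k. diffs a k * (y - x) ^ k))) (at (y - x))"
    using DERIV_cong_ev[OF refl ev refl] d by (rule iffD1)
  then have "(g has_field_derivative (suminf (\<lambda>k. diffs a k * (y - x) ^ k))) (at y)"
    using DERIV_shift[of g _ "y - x" x] by (simp add: add.commute)
  then have "deriv g y = (suminf (\<lambda>k. diffs a k * (y - x) ^ k))"
    by (rule DERIV_imp_deriv)
  moreover have "(\<lambda>k. diffs a k * (y - x) ^ k) sums (suminf (\<lambda>k. diffs a k * (y - x) ^ k))"
    by (rule termdiffs_sums_strong[OF g der y])
  ultimately show ?case by (simp add: g_def a_def)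
qed

text \<open>At \<open>k = 0\<close> this gives the constant term of the series differentiated
  \<open>j\<close> times. General \<open>k\<close> is carried along because the induction passes to
  \<open>Suc k\<close>.\<close>

lemma funpow_diffs:
  fixes c :: "nat \<Rightarrow> real"
  shows "fact k * (diffs ^^ j) c k = fact (j + k) * c (j + k)"
proof (induction j arbitrary: k)
  case (Suc j)
  show ?case using Suc.IH[of "Suc k"] by (simp add: diffs_def algebra_simps)
qed simp

text \<open>The first nonzero Taylor coefficient bounds the admissible values, so the
  \<open>GREATEST\<close> is attained at its index.\<close>

lemma mz_fun_eq_least:
  assumes "\<And>j. (deriv ^^ j) f x = fact j * c j" and "c m \<noteq> 0" and "\<And>k. k < m \<Longrightarrow> c k = 0"
  shows "mz_fun f x = m"
  unfolding mz_fun_def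
proof (rule Greatest_equality)
  show "\<forall>k<m. (deriv ^^ k) f x = 0" using assms by simp
  show "l \<le> m" if "\<forall>k<l. (deriv ^^ k) f x = 0" for l
    using that assms(1,2) by (metis fact_nonzero mult_eq_0_iff not_le)
qed

text \<open>Splitting off the leading power leaves a continuous factor \<open>g\<close> with nonzero
  value \<open>a m\<close> at 0, which stays between half and twice that modulus nearby.\<close>

lemma real_analytic_on_mz_fun_bounds:
  assumes "real_analytic_on f S" "x \<in> S" and nz: "\<exists>\<^sub>F y in at x. f y \<noteq> 0"
  obtains c C where "c > 0" "C > 0"
    "\<forall>\<^sub>F y in at x. c * \<bar>y - x\<bar> ^ mz_fun f x \<le> \<bar>f y\<bar> \<and> \<bar>f y\<bar> \<le> C * \<bar>y - x\<bar> ^ mz_fun f x"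
proof -
  obtain r a where r: "r > 0" and a: "\<And>y. \<bar>y - x\<bar> < r \<Longrightarrow> (\<lambda>k. a k * (y - x) ^ k) sums f y"
    using assms(1,2) unfolding real_analytic_on_def by blast
  have near: "\<forall>\<^sub>F y in at x. \<bar>y - x\<bar> < r"
    using eventually_at_ball[OF r, of x UNIV] by (simp add: dist_real_def abs_minus_commute)
  have der: "(deriv ^^ j) f x = fact j * a j" for j
  proof -
    have "(\<lambda>k. (diffs ^^ j) a k * (x - x) ^ k) sums (deriv ^^ j) f x"
      by (rule higher_deriv_powser[OF a]) (use r in auto)
    then have "(\<lambda>k. (diffs ^^ j) a k * 0 ^ k) sums (deriv ^^ j) f x"
      by (simp only: diff_self)
    then have "(deriv ^^ j) f x = (diffs ^^ j) a 0"
      using powser_sums_zero by (rule sums_unique2)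
    then show ?thesis using funpow_diffs[of 0 j a] by simp
  qed
  \<comment> \<open>If all coefficients vanished, \<open>f\<close> would be zero near
    \<open>x\<close>, contradicting \<open>nz\<close>.\<close>
  have "\<exists>k. a k \<noteq> 0"
  proof (rule ccontr)
    assume "\<nexists>k. a k \<noteq> 0"
    then have "\<forall>\<^sub>F y in at x. f y = 0"
      using near by (auto elim!: eventually_mono dest!: a intro: sums_unique2[OF _ sums_zero])
    then show False using nz by (simp add: frequently_def)
  qed
  define m where "m = (LEAST k. a k \<noteq> 0)"
  have m: "a m \<noteq> 0" "\<And>k. k < m \<Longrightarrow> a k = 0"
    unfolding m_def using LeastI_ex[OF \<open>\<exists>k. a k \<noteq> 0\<close>] not_less_Least by blast+
  have mz: "mz_fun f x = m"
    using der m by (rule mz_fun_eq_least)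
  define g where "g = (\<lambda>h. suminf (\<lambda>k. a (k + m) * h ^ k))"
  have shift: "(\<lambda>k. a (k + m) * (y - x) ^ (k + m)) sums f y" if "\<bar>y - x\<bar> < r" for y
    using sums_split_initial_segment[OF a[OF that], of m] m(2) by simp
  have summ: "summable (\<lambda>k. a (k + m) * (y - x) ^ k)" if "\<bar>y - x\<bar> < r" "y \<noteq> x" for y
    using summable_divide[OF sums_summable[OF shift[OF that(1)]], of "(y - x) ^ m"] that(2)
    by (simp add: power_add)
  have f_eq: "f y = (y - x) ^ m * g (y - x)" if "\<bar>y - x\<bar> < r" "y \<noteq> x" for y
  proof -
    have "(\<lambda>k. (y - x) ^ m * (a (k + m) * (y - x) ^ k)) sums ((y - x) ^ m * g (y - x))"
      unfolding g_def by (rule sums_mult[OF summable_sums[OF summ[OF that]]])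
    then show ?thesis
      using sums_unique2[OF shift[OF that(1)]] by (simp add: power_add mult_ac)
  qed
  \<comment> \<open>Convergence at the single point \<open>r / 2\<close> gives continuity inside
    that radius, in particular at the centre.\<close>
  have "isCont g 0"
    unfolding g_def using summ[of "x + r / 2"] r by (intro isCont_powser[of _ "r / 2"]) auto
  then have "isCont (\<lambda>y. \<bar>g (y - x)\<bar>) x"
    by (intro continuous_intros isCont_o2[of x "\<lambda>y. y - x" g]) auto
  then have lim: "((\<lambda>y. \<bar>g (y - x)\<bar>) \<longlongrightarrow> \<bar>a m\<bar>) (at x)"
    unfolding isCont_def by (simp add: g_def)
  have "\<forall>\<^sub>F y in at x. \<bar>a m\<bar> / 2 < \<bar>g (y - x)\<bar>" "\<forall>\<^sub>F y in at x. \<bar>g (y - x)\<bar> < 2 * \<bar>a m\<bar>"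
    using order_tendstoD(1)[OF lim, of "\<bar>a m\<bar> / 2"] order_tendstoD(2)[OF lim, of "2 * \<bar>a m\<bar>"] m(1)
    by simp_all
  moreover have "\<forall>\<^sub>F y in at x. y \<noteq> x" by (simp add: eventually_at_filter)
  ultimately have "\<forall>\<^sub>F y in at x. \<bar>a m\<bar> / 2 * \<bar>y - x\<bar> ^ m \<le> \<bar>f y\<bar> \<and> \<bar>f y\<bar> \<le> 2 * \<bar>a m\<bar> * \<bar>y - x\<bar> ^ m"
    using near
  proof eventually_elim
    case (elim y)
    have "\<bar>f y\<bar> = \<bar>g (y - x)\<bar> * \<bar>y - x\<bar> ^ m"
      using f_eq[of y] elim by (simp add: abs_mult power_abs)
    then show ?case using elim by (simp add: mult_right_mono)
  qed
  then show ?thesis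
    using that[of "\<bar>a m\<bar> / 2" "2 * \<bar>a m\<bar>"] m(1) mz by simp
qed

section \<open>Comparison of powers, and polynomials along the circle\<close>

lemma bounds_of_tendsto_quotient:
  fixes g :: "real \<Rightarrow> real"
  assumes lim: "((\<lambda>y. g y / \<bar>y - x\<bar> ^ k) \<longlongrightarrow> L) (at x)" and L: "L > 0"
  obtains c C where "c > 0" "C > 0"
    "\<forall>\<^sub>F y in at x. c * \<bar>y - x\<bar> ^ k \<le> g y \<and> g y \<le> C * \<bar>y - x\<bar> ^ k"
proof -
  have "\<forall>\<^sub>F y in at x. L / 2 < g y / \<bar>y - x\<bar> ^ k" "\<forall>\<^sub>F y in at x. g y / \<bar>y - x\<bar> ^ k < 2 * L"
    using order_tendstoD(1)[OF lim, of "L / 2"] order_tendstoD(2)[OF lim, of "2 * L"] L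
    by simp_all
  moreover have "\<forall>\<^sub>F y in at x. y \<noteq> x" by (simp add: eventually_at_filter)
  ultimately have "\<forall>\<^sub>F y in at x. L / 2 * \<bar>y - x\<bar> ^ k \<le> g y \<and> g y \<le> 2 * L * \<bar>y - x\<bar> ^ k"
  proof eventually_elim
    case (elim y)
    then have "\<bar>y - x\<bar> ^ k > 0" by simp
    with elim show ?case by (simp add: field_simps)
  qed
  then show ?thesis using that[of "L / 2" "2 * L"] L by simp
qed

text \<open>If \<open>b < a\<close>, dividing by \<open>\<bar>y - x\<bar> ^ b\<close> and letting
  \<open>y\<close> tend to \<open>x\<close> would give \<open>c \<le> 0\<close>.\<close>

lemma power_bound_imp_le:
  fixes x :: real
  assumes c: "c > 0" and ev: "\<forall>\<^sub>F y in at x. c * \<bar>y - x\<bar> ^ b \<le> C * \<bar>y - x\<bar> ^ a"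
  shows "a \<le> b"
proof (rule ccontr)
  assume "\<not> a \<le> b"
  then have ab: "a = b + (a - b)" "a - b \<noteq> 0" by auto
  have "\<forall>\<^sub>F y in at x. y \<noteq> x" by (simp add: eventually_at_filter)
  with ev have "\<forall>\<^sub>F y in at x. c \<le> C * \<bar>y - x\<bar> ^ (a - b)"
  proof eventually_elim
    case (elim y)
    have "C * \<bar>y - x\<bar> ^ a = C * \<bar>y - x\<bar> ^ (a - b) * \<bar>y - x\<bar> ^ b"
      using ab(1) by (metis add.commute mult.assoc power_add)
    with elim show ?case by (simp add: mult_le_cancel_right)
  qed
  moreover have "((\<lambda>y. C * \<bar>y - x\<bar> ^ (a - b)) \<longlongrightarrow> C * \<bar>x - x\<bar> ^ (a - b)) (at x)"
    by (intro tendsto_intros)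
  ultimately have "c \<le> C * \<bar>x - x\<bar> ^ (a - b)"
    by (intro tendsto_lowerbound) auto
  moreover have "\<bar>x - x\<bar> ^ (a - b) = 0"
    using ab(2) by (simp only: diff_self abs_zero power_0_left if_False)
  ultimately show False using c by (metis mult_zero_right not_le)
qed

lemma cmod_cis_diff: "cmod (cis a - cis b) = 2 * \<bar>sin ((a - b) / 2)\<bar>"
proof -
  have "cis a - cis b = cis b * (cis (a - b) - 1)"
    by (simp add: algebra_simps cis_mult)
  then show ?thesis
    using dist_exp_i_1[of "a - b"] by (simp add: norm_mult cis_conv_exp)
qed

text \<open>Chord and arc agree to first order, so the order of vanishing in the variable on the
  circle becomes the order in the angle.\<close>

lemma tendsto_cmod_cis_diff_quotient:
  "((\<lambda>y. cmod (cis (- y) - cis (- x)) / \<bar>y - x\<bar>) \<longlongrightarrow> 1) (at x)"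
proof -
  have "((\<lambda>h. sin h / h) \<longlongrightarrow> 1) (at (0::real))"
    using DERIV_D[OF DERIV_sin[of "0::real"]] by simp
  moreover have "filterlim (\<lambda>y. (y - x) / 2) (at 0) (at x)"
    by (auto simp: filterlim_at eventually_at_filter intro!: tendsto_eq_intros)
  ultimately have "((\<lambda>y. sin ((y - x) / 2) / ((y - x) / 2)) \<longlongrightarrow> 1) (at x)"
    by (rule filterlim_compose)
  then have "((\<lambda>y. \<bar>sin ((y - x) / 2) / ((y - x) / 2)\<bar>) \<longlongrightarrow> \<bar>1\<bar>) (at x)"
    by (rule tendsto_rabs)
  moreover have "\<bar>sin ((y - x) / 2) / ((y - x) / 2)\<bar> = cmod (cis (- y) - cis (- x)) / \<bar>y - x\<bar>" for y
  proof -
    have "(- y - - x) / 2 = - ((y - x) / 2)"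
      by (simp only: minus_divide_left minus_diff_eq diff_minus_eq_add uminus_add_conv_diff)
    then have "cmod (cis (- y) - cis (- x)) = 2 * \<bar>sin ((y - x) / 2)\<bar>"
      by (simp only: cmod_cis_diff sin_minus abs_minus_cancel)
    then show ?thesis by (simp add: abs_divide abs_mult)
  qed
  ultimately show ?thesis by (simp only: abs_one)
qed

text \<open>Splitting off the root with its full multiplicity leaves a factor \<open>q\<close> that
  is nonzero at the point; the linear factors are measured by the chord.\<close>

lemma poly_cis_bounds:
  assumes "p \<noteq> 0"
  obtains c C where "c > 0" "C > 0"
    "\<forall>\<^sub>F y in at x. c * \<bar>y - x\<bar> ^ mz_poly p (cis (- x)) \<le> cmod (poly p (cis (- y))) \<and>
       cmod (poly p (cis (- y))) \<le> C * \<bar>y - x\<bar> ^ mz_poly p (cis (- x))"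
proof -
  let ?z = "cis (- x)" and ?k = "mz_poly p (cis (- x))"
  obtain q where q: "p = [:- ?z, 1:] ^ ?k * q" "\<not> [:- ?z, 1:] dvd q"
    using order_decomp[OF assms] unfolding mz_poly_def by blast
  have "((\<lambda>y. (cmod (cis (- y) - ?z) / \<bar>y - x\<bar>) ^ ?k * cmod (poly q (cis (- y)))) \<longlongrightarrow>
      1 ^ ?k * cmod (poly q (cis (- x)))) (at x)"
    by (intro tendsto_mult tendsto_power tendsto_cmod_cis_diff_quotient tendsto_norm)
       (auto intro!: tendsto_intros)
  then have "((\<lambda>y. cmod (poly p (cis (- y))) / \<bar>y - x\<bar> ^ ?k) \<longlongrightarrow> cmod (poly q ?z)) (at x)"
    by (subst q(1)) (simp add: norm_mult norm_power power_divide)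
  moreover have "cmod (poly q ?z) > 0"
    using q(2) by (simp add: poly_eq_0_iff_dvd)
  ultimately show ?thesis
    using that by (rule bounds_of_tendsto_quotient)
qed

lemma order_mono_of_dvd_chain:
  assumes "\<forall>j. Suc j < n \<longrightarrow> d j dvd d (Suc j)" and "\<forall>j<n. lead_coeff (d j) = (1::complex)"
    and "i \<le> j" "j < n"
  shows "mz_poly (d i) z \<le> mz_poly (d j) z"
  using assms(3,4)
proof (induction j rule: dec_induct)
  case (step k)
  have "d (Suc k) \<noteq> 0" using assms(2) step.prems by force
  then have "mz_poly (d k) z \<le> mz_poly (d (Suc k)) z"
    unfolding mz_poly_def using assms(1) step.prems by (intro dvd_imp_order_le) auto
  then show ?case using step by simp
qed simp

section \<open>Constants common to finitely many functions\<close>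

lemma uniform_eventually_lower:
  fixes g :: "nat \<Rightarrow> real \<Rightarrow> real" and h :: "nat \<Rightarrow> real \<Rightarrow> real"
  assumes h: "\<And>i y. h i y \<ge> 0"
    and "\<And>i. i < n \<Longrightarrow> \<exists>c>0. \<forall>\<^sub>F y in F. c * h i y \<le> g i y"
  obtains c where "c > 0" "\<forall>\<^sub>F y in F. \<forall>i<n. c * h i y \<le> g i y"
proof -
  obtain f where f: "\<And>i. i < n \<Longrightarrow> f i > 0 \<and> (\<forall>\<^sub>F y in F. f i * h i y \<le> g i y)"
    using assms(2) by metis
  \<comment> \<open>The extra element 1 covers \<open>n = 0\<close>, where the minimum would run
    over the empty set.\<close>
  define c where "c = Min (insert 1 (f ` {..<n}))"
  have "c > 0" using f by (simp add: c_def)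
  moreover have "c \<le> f i" if "i < n" for i using that by (simp add: c_def)
  then have "\<forall>\<^sub>F y in F. c * h i y \<le> g i y" if "i < n" for i
    using f[OF that] that h by (auto elim!: eventually_mono intro: order_trans[OF mult_right_mono])
  then have "\<forall>\<^sub>F y in F. \<forall>i\<in>{..<n}. c * h i y \<le> g i y"
    by (intro eventually_ball_finite) auto
  ultimately show ?thesis by (intro that) (simp_all add: Ball_def)
qed

lemma uniform_eventually_upper:
  fixes g :: "nat \<Rightarrow> real \<Rightarrow> real" and h :: "nat \<Rightarrow> real \<Rightarrow> real"
  assumes h: "\<And>i y. h i y \<ge> 0"
    and "\<And>i. i < n \<Longrightarrow> \<exists>C. \<forall>\<^sub>F y in F. g i y \<le> C * h i y"
  obtains C where "C > 0" "\<forall>\<^sub>F y in F. \<forall>i<n. g i y \<le> C * h i y"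
proof -
  obtain f where f: "\<And>i. i < n \<Longrightarrow> \<forall>\<^sub>F y in F. g i y \<le> f i * h i y"
    using assms(2) by metis
  \<comment> \<open>Inserting 1 covers \<open>n = 0\<close> and makes \<open>C\<close> positive, as
    the \<open>f i\<close> may have any sign.\<close>
  define C where "C = Max (insert 1 (f ` {..<n}))"
  have "C \<ge> 1" by (simp add: C_def)
  then have "C > 0" by simp
  moreover have "f i \<le> C" if "i < n" for i using that by (simp add: C_def)
  then have "\<forall>\<^sub>F y in F. g i y \<le> C * h i y" if "i < n" for i
    using f[OF that] that h by (auto elim!: eventually_mono intro: order_trans[OF _ mult_right_mono])
  then have "\<forall>\<^sub>F y in F. \<forall>i\<in>{..<n}. g i y \<le> C * h i y"
    by (intro eventually_ball_finite) auto
  ultimately show ?thesis by (intro that) (simp_all add: Ball_def)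
qed

subsection \<open>Multiplicities of invariant polynomials and of eigenvalues\<close>

theorem theorem4p8:
  fixes n :: nat and A :: "lpoly mat" and \<xi>0 :: real
    and d :: "nat \<Rightarrow> complex poly" and lam :: "nat \<Rightarrow> real \<Rightarrow> real"
  assumes "A \<in> carrier_mat n n"
    and "hermite_lmat A"
    and "det A \<noteq> 0"
    and "invariant_polys n A d"
    and "\<forall>j<n. real_analytic_on (lam j) UNIV"
    and "\<forall>\<xi>::real. char_poly (lmat_eval A (cis (-\<xi>))) =
                    (\<Prod>j<n. [:- complex_of_real (lam j \<xi>), 1:])"
    and "\<forall>i j. i \<le> j \<longrightarrow> j < n \<longrightarrow> mz_fun (lam i) \<xi>0 \<le> mz_fun (lam j) \<xi>0"
  shows "\<forall>j<n. mz_poly (d j) (cis (-\<xi>0)) = mz_fun (lam j) \<xi>0"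
proof -
  define \<alpha> where "\<alpha> = (\<lambda>j. mz_poly (d j) (cis (-\<xi>0)))"
  define \<beta> where "\<beta> = (\<lambda>j. mz_fun (lam j) \<xi>0)"
  define H where "H = (\<lambda>y. lmat_eval A (cis (- y)))"
  define dd where "dd = (\<lambda>i y. poly (d i) (cis (- y)))"
  obtain E F where E: "E \<in> carrier_mat n n" and F: "F \<in> carrier_mat n n"
    and uni: "unimodular_lmat E" "unimodular_lmat F"
    and AEF: "A = E * mat n n (\<lambda>(i,j). if i = j then lpoly_of_poly (d i) else 0) * F"
    and monic: "\<forall>j<n. lead_coeff (d j) = 1"
    and chain: "\<forall>j. Suc j < n \<longrightarrow> d j dvd d (Suc j)"
    using assms(4) unfolding invariant_polys_def by blast
  have d0: "d j \<noteq> 0" if "j < n" for j using monic that by force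
  have \<alpha>_mono: "\<alpha> i \<le> \<alpha> j" if "i \<le> j" "j < n" for i j
    unfolding \<alpha>_def using order_mono_of_dvd_chain[OF chain monic that] .
  have H: "H y \<in> carrier_mat n n" "mat_adjoint (H y) = H y" for y
    using assms(1) lmat_eval_hermite[OF assms(1,2)] by (auto simp: H_def lmat_eval_def)
  have cp: "char_poly (H y) = (\<Prod>j<n. [:- complex_of_real (lam j y), 1:])" for y
    using assms(6) by (simp add: H_def)
  have Ec: "lmat_eval E z \<in> carrier_mat n n" and Fc: "lmat_eval F z \<in> carrier_mat n n" for z
    using E F by (auto simp: lmat_eval_def)
  have HEF: "H y = lmat_eval E (cis (- y)) * mat n n (\<lambda>(i,j). if i = j then dd i y else 0) * lmat_eval F (cis (- y))" for y
    unfolding H_def dd_def AEF by (rule lmat_eval_smith[OF _ E F]) simp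
  obtain CE where CE: "\<And>z i j. cmod z = 1 \<Longrightarrow> i < n \<Longrightarrow> j < n \<Longrightarrow> cmod (lmat_eval E z $$ (i, j)) \<le> CE"
    using cmod_lmat_eval_bound[of E] E by auto
  obtain CF where CF: "\<And>z i j. cmod z = 1 \<Longrightarrow> i < n \<Longrightarrow> j < n \<Longrightarrow> cmod (lmat_eval F z $$ (i, j)) \<le> CF"
    using cmod_lmat_eval_bound[of F] F by auto
  obtain cE where cE: "cE > 0" "\<And>z. cmod z = 1 \<Longrightarrow> cmod (det (lmat_eval E z)) = cE"
    using cmod_det_unimodular[OF uni(1)] by blast
  obtain cF where cF: "cF > 0" "\<And>z. cmod z = 1 \<Longrightarrow> cmod (det (lmat_eval F z)) = cF"
    using cmod_det_unimodular[OF uni(2)] by blast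
  \<comment> \<open>On the circle the determinants of the unimodular factors only contribute the
    constant \<open>cE * cF\<close>.\<close>
  have det: "(\<Prod>j<n. \<bar>lam j y\<bar>) = cE * cF * (\<Prod>j<n. cmod (dd j y))" for y
  proof -
    let ?D = "mat n n (\<lambda>(i,j). if i = j then dd i y else 0)"
    have D: "?D \<in> carrier_mat n n" by simp
    have "upper_triangular ?D" by auto
    then have "det ?D = (\<Prod>j<n. dd j y)"
      using det_upper_triangular[OF _ D] by (simp add: prod_list_diag_prod atLeast0LessThan)
    then have "det (H y) = det (lmat_eval E (cis (- y))) * (\<Prod>j<n. dd j y) * det (lmat_eval F (cis (- y)))"
      unfolding HEF by (simp add: det_mult[OF mult_carrier_mat[OF Ec D] Fc] det_mult[OF Ec D])
    then have "cmod (det (H y)) = cE * cF * (\<Prod>j<n. cmod (dd j y))"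
      using cE(2) cF(2) by (simp add: norm_mult prod_norm)
    moreover have "cmod (det (H y)) = (\<Prod>j<n. \<bar>lam j y\<bar>)"
      using det_eq_prod_roots[OF H(1) cp] by (simp add: prod_norm[symmetric])
    ultimately show ?thesis by simp
  qed
  have dd_bounds: "\<exists>c>0. \<exists>C. \<forall>\<^sub>F y in at \<xi>0. c * \<bar>y - \<xi>0\<bar> ^ \<alpha> i \<le> cmod (dd i y) \<and> cmod (dd i y) \<le> C * \<bar>y - \<xi>0\<bar> ^ \<alpha> i"
    if "i < n" for i
    unfolding \<alpha>_def dd_def by (rule poly_cis_bounds[OF d0[OF that], of \<xi>0]) blast
  have "\<exists>c>0. \<forall>\<^sub>F y in at \<xi>0. c * \<bar>y - \<xi>0\<bar> ^ \<alpha> i \<le> cmod (dd i y)" if "i < n" for i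
    using dd_bounds[OF that] by (auto elim!: eventually_mono)
  then obtain c1 where c1: "c1 > 0" "\<forall>\<^sub>F y in at \<xi>0. \<forall>i<n. c1 * \<bar>y - \<xi>0\<bar> ^ \<alpha> i \<le> cmod (dd i y)"
    using uniform_eventually_lower[of "\<lambda>i y. \<bar>y - \<xi>0\<bar> ^ \<alpha> i" n "\<lambda>i y. cmod (dd i y)" "at \<xi>0"] by auto
  have "\<exists>C. \<forall>\<^sub>F y in at \<xi>0. cmod (dd i y) \<le> C * \<bar>y - \<xi>0\<bar> ^ \<alpha> i" if "i < n" for i
    using dd_bounds[OF that] by (auto elim!: eventually_mono)
  then obtain C1 where C1: "C1 > 0" "\<forall>\<^sub>F y in at \<xi>0. \<forall>i<n. cmod (dd i y) \<le> C1 * \<bar>y - \<xi>0\<bar> ^ \<alpha> i"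
    using uniform_eventually_upper[of "\<lambda>i y. \<bar>y - \<xi>0\<bar> ^ \<alpha> i" n "\<lambda>i y. cmod (dd i y)" "at \<xi>0"] by auto
  have neq: "\<forall>\<^sub>F y in at \<xi>0. y \<noteq> \<xi>0" by (simp add: eventually_at_filter)
  \<comment> \<open>Near \<open>\<xi>0\<close>, but off it, the right side of \<open>det\<close> is
    positive, so no eigenvalue vanishes there. Hence every \<open>lam i\<close> has a finite order
    at \<open>\<xi>0\<close>.\<close>
  have nz: "\<forall>\<^sub>F y in at \<xi>0. \<forall>i<n. lam i y \<noteq> 0"
    using c1(2) neq
  proof eventually_elim
    case (elim y)
    have "cmod (dd i y) > 0" if "i < n" for i
    proof -
      have "0 < c1 * \<bar>y - \<xi>0\<bar> ^ \<alpha> i" using c1(1) elim(2) by simp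
      also have "\<dots> \<le> cmod (dd i y)" using elim(1) that by blast
      finally show ?thesis .
    qed
    then have "(\<Prod>j<n. \<bar>lam j y\<bar>) \<noteq> 0"
      unfolding det using cE(1) cF(1) by (auto simp: prod_zero_iff)
    then show ?case by (simp add: prod_zero_iff)
  qed
  have lam_bounds: "\<exists>c>0. \<exists>C. \<forall>\<^sub>F y in at \<xi>0. c * \<bar>y - \<xi>0\<bar> ^ \<beta> i \<le> \<bar>lam i y\<bar> \<and> \<bar>lam i y\<bar> \<le> C * \<bar>y - \<xi>0\<bar> ^ \<beta> i"
    if i: "i < n" for i
  proof -
    have freq: "\<exists>\<^sub>F y in at \<xi>0. lam i y \<noteq> 0"
      using nz i by (intro eventually_frequently) (auto elim!: eventually_mono)
    have "real_analytic_on (lam i) UNIV" using assms(5) i by blast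
    from real_analytic_on_mz_fun_bounds[OF this UNIV_I freq] show ?thesis
      unfolding \<beta>_def by blast
  qed
  have "\<exists>c>0. \<forall>\<^sub>F y in at \<xi>0. c * \<bar>y - \<xi>0\<bar> ^ \<beta> i \<le> \<bar>lam i y\<bar>" if "i < n" for i
    using lam_bounds[OF that] by (auto elim!: eventually_mono)
  then obtain c2 where c2: "c2 > 0" "\<forall>\<^sub>F y in at \<xi>0. \<forall>i<n. c2 * \<bar>y - \<xi>0\<bar> ^ \<beta> i \<le> \<bar>lam i y\<bar>"
    using uniform_eventually_lower[of "\<lambda>i y. \<bar>y - \<xi>0\<bar> ^ \<beta> i" n "\<lambda>i y. \<bar>lam i y\<bar>" "at \<xi>0"] by auto
  have "\<exists>C. \<forall>\<^sub>F y in at \<xi>0. \<bar>lam i y\<bar> \<le> C * \<bar>y - \<xi>0\<bar> ^ \<beta> i" if "i < n" for i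
    using lam_bounds[OF that] by (auto elim!: eventually_mono)
  then obtain C2 where C2: "C2 > 0" "\<forall>\<^sub>F y in at \<xi>0. \<forall>i<n. \<bar>lam i y\<bar> \<le> C2 * \<bar>y - \<xi>0\<bar> ^ \<beta> i"
    using uniform_eventually_upper[of "\<lambda>i y. \<bar>y - \<xi>0\<bar> ^ \<beta> i" n "\<lambda>i y. \<bar>lam i y\<bar>" "at \<xi>0"] by auto
  \<comment> \<open>Within distance 1 a larger exponent gives a smaller power, so bounds with
    different exponents can be compared.\<close>
  have near: "\<forall>\<^sub>F y in at \<xi>0. \<bar>y - \<xi>0\<bar> \<le> 1"
    using eventually_at_ball[of 1 \<xi>0 UNIV]
    by (auto elim!: eventually_mono simp: dist_real_def abs_minus_commute)
  \<comment> \<open>Among the eigenvalues up to \<open>j\<close> the weakest lower bound is the one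
    at \<open>j\<close>, and among the invariant polynomials from \<open>j\<close> on the weakest
    upper bound is the one at \<open>j\<close>. The pointwise minimax bound then compares these two
    powers.\<close>
  have le: "\<alpha> j \<le> \<beta> j" if j: "j < n" for j
  proof -
    let ?K = "(real n * CE) * C1 * (real n * CF)"
    have "\<forall>\<^sub>F y in at \<xi>0. c2 * \<bar>y - \<xi>0\<bar> ^ \<beta> j \<le> ?K * \<bar>y - \<xi>0\<bar> ^ \<alpha> j"
      using c2(2) C1(2) near
    proof eventually_elim
      case (elim y)
      have "c2 * \<bar>y - \<xi>0\<bar> ^ \<beta> j \<le> (real n * CE) * (C1 * \<bar>y - \<xi>0\<bar> ^ \<alpha> j) * (real n * CF)"
      proof (rule hermitian_factorization_bound[OF H[of y] cp Ec CE Fc CF HEF j])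
        show "0 \<le> c2 * \<bar>y - \<xi>0\<bar> ^ \<beta> j" using c2(1) by simp
        show "c2 * \<bar>y - \<xi>0\<bar> ^ \<beta> j \<le> \<bar>lam i y\<bar>" if "i \<le> j" for i
        proof -
          have "\<beta> i \<le> \<beta> j" using assms(7) that j by (simp add: \<beta>_def)
          then have "c2 * \<bar>y - \<xi>0\<bar> ^ \<beta> j \<le> c2 * \<bar>y - \<xi>0\<bar> ^ \<beta> i"
            using elim(3) c2(1) by (intro mult_left_mono power_decreasing) auto
          also have "\<dots> \<le> \<bar>lam i y\<bar>" using elim(1) that j by simp
          finally show ?thesis .
        qed
        show "cmod (dd i y) \<le> C1 * \<bar>y - \<xi>0\<bar> ^ \<alpha> j" if "j \<le> i" "i < n" for i
        proof -
          have "cmod (dd i y) \<le> C1 * \<bar>y - \<xi>0\<bar> ^ \<alpha> i" using elim(2) that by simp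
          also have "\<dots> \<le> C1 * \<bar>y - \<xi>0\<bar> ^ \<alpha> j"
            using elim(3) C1(1) \<alpha>_mono[OF that] by (intro mult_left_mono power_decreasing) auto
          finally show ?thesis .
        qed
      qed simp_all
      then show ?case by (simp add: mult_ac)
    qed
    with c2(1) show ?thesis by (rule power_bound_imp_le)
  qed
  \<comment> \<open>The reverse inequality is obtained for the sums: bounding the product identity
    \<open>det\<close> below through the \<open>dd j\<close> and above through the
    \<open>lam j\<close> leaves one power on each side.\<close>
  have "\<forall>\<^sub>F y in at \<xi>0. (cE * cF * c1 ^ n) * \<bar>y - \<xi>0\<bar> ^ (\<Sum>j<n. \<alpha> j) \<le> C2 ^ n * \<bar>y - \<xi>0\<bar> ^ (\<Sum>j<n. \<beta> j)"
    using c1(2) C2(2)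
  proof eventually_elim
    case (elim y)
    have "(cE * cF * c1 ^ n) * \<bar>y - \<xi>0\<bar> ^ (\<Sum>j<n. \<alpha> j) = cE * cF * (\<Prod>j<n. c1 * \<bar>y - \<xi>0\<bar> ^ \<alpha> j)"
      by (simp add: prod.distrib power_sum)
    also have "\<dots> \<le> cE * cF * (\<Prod>j<n. cmod (dd j y))"
      using elim(1) c1(1) cE(1) cF(1) by (intro mult_left_mono prod_mono) auto
    also have "\<dots> = (\<Prod>j<n. \<bar>lam j y\<bar>)" by (simp add: det)
    also have "\<dots> \<le> (\<Prod>j<n. C2 * \<bar>y - \<xi>0\<bar> ^ \<beta> j)"
      using elim(2) by (intro prod_mono) auto
    also have "\<dots> = C2 ^ n * \<bar>y - \<xi>0\<bar> ^ (\<Sum>j<n. \<beta> j)"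
      by (simp add: prod.distrib power_sum)
    finally show ?case .
  qed
  then have "(\<Sum>j<n. \<beta> j) \<le> (\<Sum>j<n. \<alpha> j)"
    using c1(1) cE(1) cF(1) by (intro power_bound_imp_le) auto
  moreover have "(\<Sum>j<n. \<alpha> j) \<le> (\<Sum>j<n. \<beta> j)"
    using le by (intro sum_mono) auto
  ultimately have "(\<Sum>j<n. \<alpha> j) = (\<Sum>j<n. \<beta> j)" by simp
  \<comment> \<open>Termwise inequalities between families with equal sums are equalities.\<close>
  then have "\<alpha> j = \<beta> j" if "j < n" for j
    using sum_mono_inv[of \<alpha> "{..<n}" \<beta> j] le that by auto
  then show ?thesis by (simp add: \<alpha>_def \<beta>_def)
qed

end
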